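(* If $\mathcal{P}$ is a finite-dimensional Poisson algebra over an arbitrary field $\mathbb{F}$, then its Frattini ideal $\phi(\mathcal{P})$ is nilpotent.
   Context: A Poisson algebra $(\mathcal{P},\cdot,[\cdot,\cdot])$ over $\mathbb{F}$ is a vector space with two bilinear products such that $(\mathcal{P},\cdot)$ is a commutative associative algebra (not necessarily unital), $(\mathcal{P},[\cdot,\cdot])$ is a Lie algebra, and $[x\cdot y,z]=[x,z]\cdot y+x\cdot[y,z]$ for all $x,y,z$. A subalgebra is a subspace closed under both products; an ideal is a subspace $I$ with $I\cdot\mathcal{P}+[I,\mathcal{P}]\subseteq I$. The Frattini subalgebra $F(\mathcal{P})$ is the intersection of the maximal (proper) subalgebras of $\mathcal{P}$, and the Frattini ideal $\phi(\mathcal{P})$ is the largest ideal of $\mathcal{P}$ contained in $F(\mathcal{P})$. A Poisson algebra $A$ is nilpotent if $A^m=0$ for some $m$, where $A^1=A$ and $A^{n+1}=\sum_{i=1}^{n}(A^i\cdot A^{n+1-i}+[A^i,A^{n+1-i}])$ (products of subspaces are linear spans). *)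

theory Defs
  imports Complex_Main
begin

text \<open>The library locale \<^locale>\<open>vector_space\<close> is over an arbitrary field, so characteristic 2 is
  included; hence the bracket is required to be alternating, not merely antisymmetric. The
  commutative product need not have a unit.\<close>

locale poisson_algebra = vector_space scale
  for scale :: "'f::field \<Rightarrow> 'a::ab_group_add \<Rightarrow> 'a" +
  fixes mult :: "'a \<Rightarrow> 'a \<Rightarrow> 'a"
    and bracket :: "'a \<Rightarrow> 'a \<Rightarrow> 'a"
  assumes mult_add_left: "mult (x + y) z = mult x z + mult y z"
    and mult_add_right: "mult x (y + z) = mult x y + mult x z"
    and mult_scale_left: "mult (scale c x) y = scale c (mult x y)"
    and mult_scale_right: "mult x (scale c y) = scale c (mult x y)"
    and mult_commute: "mult x y = mult y x"
    and mult_assoc: "mult (mult x y) z = mult x (mult y z)"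
    and bracket_add_left: "bracket (x + y) z = bracket x z + bracket y z"
    and bracket_add_right: "bracket x (y + z) = bracket x y + bracket x z"
    and bracket_scale_left: "bracket (scale c x) y = scale c (bracket x y)"
    and bracket_scale_right: "bracket x (scale c y) = scale c (bracket x y)"
    and bracket_self: "bracket x x = 0"
    and jacobi: "bracket x (bracket y z) + bracket y (bracket z x) + bracket z (bracket x y) = 0"
    and leibniz: "bracket (mult x y) z = mult (bracket x z) y + mult x (bracket y z)"
begin

definition subalgebra :: "'a set \<Rightarrow> bool" where
  "subalgebra S \<longleftrightarrow> subspace S \<and> (\<forall>x\<in>S. \<forall>y\<in>S. mult x y \<in> S \<and> bracket x y \<in> S)"

definition poisson_ideal :: "'a set \<Rightarrow> bool" where
  "poisson_ideal I \<longleftrightarrow> subspace I \<and> (\<forall>x\<in>I. \<forall>p. mult x p \<in> I \<and> bracket x p \<in> I)"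

definition maximal_subalgebra :: "'a set \<Rightarrow> bool" where
  "maximal_subalgebra M \<longleftrightarrow> subalgebra M \<and> M \<noteq> UNIV \<and>
     (\<forall>S. subalgebra S \<and> M \<subseteq> S \<longrightarrow> S = M \<or> S = UNIV)"

text \<open>If there is no maximal subalgebra, the intersection is the whole algebra.\<close>

definition frattini_subalgebra :: "'a set" where
  "frattini_subalgebra = \<Inter>{M. maximal_subalgebra M}"

definition frattini_ideal :: "'a set" where
  "frattini_ideal = (GREATEST I. poisson_ideal I \<and> I \<subseteq> frattini_subalgebra)"

definition mult_span :: "'a set \<Rightarrow> 'a set \<Rightarrow> 'a set" where
  "mult_span U V = span {mult u v | u v. u \<in> U \<and> v \<in> V}"

definition bracket_span :: "'a set \<Rightarrow> 'a set \<Rightarrow> 'a set" where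
  "bracket_span U V = span {bracket u v | u v. u \<in> U \<and> v \<in> V}"

text \<open>The powers of a subalgebra \<open>A\<close>, regarded as a Poisson algebra in its own right; the sum of
  subspaces is the span of their union. The sequence starts at 1: the value at 0 is a dummy.\<close>

fun poisson_power :: "'a set \<Rightarrow> nat \<Rightarrow> 'a set" where
  "poisson_power A n = (if n \<le> 1 then A else
     span (\<Union>i\<in>{1..<n}. mult_span (poisson_power A i) (poisson_power A (n - i))
                      \<union> bracket_span (poisson_power A i) (poisson_power A (n - i))))"

declare poisson_power.simps [simp del]

definition nilpotent :: "'a set \<Rightarrow> bool" where
  "nilpotent A \<longleftrightarrow> subalgebra A \<and> (\<exists>m\<ge>1. poisson_power A m = {0})"

lemma poisson_power_1: "poisson_power A 1 = A"
  by (subst poisson_power.simps) simp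

lemma poisson_power_Suc:
  assumes "n \<ge> 1"
  shows "poisson_power A (n + 1) =
    span (\<Union>i\<in>{1..n}. mult_span (poisson_power A i) (poisson_power A (n + 1 - i))
                    \<union> bracket_span (poisson_power A i) (poisson_power A (n + 1 - i)))"
proof -
  have "{1..<n + 1} = {1..n}" by auto
  with assms show ?thesis by (subst poisson_power.simps) simp
qed

lemma subspace_subalgebra: "subalgebra S \<Longrightarrow> subspace S"
  by (simp add: subalgebra_def)

lemma subspace_frattini_subalgebra: "subspace frattini_subalgebra"
  unfolding frattini_subalgebra_def
  by (rule subspace_Inter) (auto simp: maximal_subalgebra_def subalgebra_def)

lemma mult_zero_left: "mult 0 y = 0"
  using mult_scale_left[of 0 0 y] by simp

lemma bracket_zero_left: "bracket 0 y = 0"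
  using bracket_scale_left[of 0 0 y] by simp

lemma poisson_ideal_span:
  assumes "\<And>I. I \<in> \<I> \<Longrightarrow> poisson_ideal I"
  shows "poisson_ideal (span (\<Union>\<I>))"
proof -
  have "mult x p \<in> span (\<Union>\<I>) \<and> bracket x p \<in> span (\<Union>\<I>)" if "x \<in> span (\<Union>\<I>)" for x p
    using that
  proof (induction rule: span_induct_alt)
    case base
    show ?case by (simp add: mult_zero_left bracket_zero_left span_zero)
  next
    case (step c x y)
    then obtain I where "I \<in> \<I>" "x \<in> I" by blast
    with assms have "mult x p \<in> \<Union>\<I>" "bracket x p \<in> \<Union>\<I>"
      by (auto simp: poisson_ideal_def)
    with step show ?case
      by (simp add: mult_add_left mult_scale_left bracket_add_left bracket_scale_left
          span_add span_scale span_base)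
  qed
  then show ?thesis by (simp add: poisson_ideal_def)
qed

text \<open>A largest ideal in the Frattini subalgebra exists, so \<open>GREATEST\<close> is well defined above.\<close>

lemma frattini_ideal_eq:
  "frattini_ideal = span (\<Union>{I. poisson_ideal I \<and> I \<subseteq> frattini_subalgebra})"
  unfolding frattini_ideal_def
proof (rule Greatest_equality)
  show "poisson_ideal (span (\<Union>{I. poisson_ideal I \<and> I \<subseteq> frattini_subalgebra})) \<and>
        span (\<Union>{I. poisson_ideal I \<and> I \<subseteq> frattini_subalgebra}) \<subseteq> frattini_subalgebra"
    by (intro conjI poisson_ideal_span span_minimal subspace_frattini_subalgebra) auto
next
  fix J
  assume "poisson_ideal J \<and> J \<subseteq> frattini_subalgebra"
  then have "J \<subseteq> \<Union>{I. poisson_ideal I \<and> I \<subseteq> frattini_subalgebra}" by blast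
  also have "\<dots> \<subseteq> span \<dots>" by (rule span_superset)
  finally show "J \<subseteq> span (\<Union>{I. poisson_ideal I \<and> I \<subseteq> frattini_subalgebra})" .
qed

lemma poisson_ideal_frattini_ideal: "poisson_ideal frattini_ideal"
  unfolding frattini_ideal_eq by (rule poisson_ideal_span) simp

lemma frattini_ideal_subset: "frattini_ideal \<subseteq> frattini_subalgebra"
  unfolding frattini_ideal_eq
  by (intro span_minimal subspace_frattini_subalgebra) auto

lemma frattini_ideal_greatest:
  "poisson_ideal J \<Longrightarrow> J \<subseteq> frattini_subalgebra \<Longrightarrow> J \<subseteq> frattini_ideal"
  unfolding frattini_ideal_eq by (auto intro: span_base)

lemma subalgebra_poisson_ideal: "poisson_ideal I \<Longrightarrow> subalgebra I"
  by (simp add: poisson_ideal_def subalgebra_def)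

end

end

theory Submission
  imports Defs
begin

text \<open>
  Let \<open>\<phi>\<close> be the Frattini ideal of \<open>P\<close>. The theorem is an Engel-type statement: every element of
  \<open>\<phi>\<close> acts nilpotently by both products, and a family of nilpotent operators that is closed under
  commutators, here all multiplications and brackets by elements of \<open>\<phi>\<close>, acts nilpotently as a
  whole.

  Nilpotency of the single operators is Barnes's argument for Lie algebras. For \<open>a \<in> \<phi>\<close> let \<open>D\<close>
  be multiplication by \<open>a\<close> or bracketing with \<open>a\<close>. The range of \<open>D\<close> lies in \<open>\<phi>\<close>, so by Fitting's
  lemma \<open>P\<close> is the sum of \<open>\<phi>\<close> and the null component of \<open>D\<close>, the set of vectors that some power
  of \<open>D\<close> kills. This null component is a subalgebra: if \<open>D\<close> is bracketing with \<open>a\<close>, because \<open>D\<close>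
  is then a derivation of both products, and if \<open>D\<close> is multiplication by \<open>a\<close>, by
  \<open>a [x, y] = [a x, y] - [a, y] x\<close>. A proper subalgebra lies in a maximal one, which also contains
  \<open>\<phi>\<close>; hence the null component is \<open>P\<close> (\<open>null_component_eq_UNIV\<close>).

  The passage to the whole of \<open>A = \<phi>\<close> follows Jacobson's proof of Engel's theorem. Call a subalgebra
  \<open>S\<close> of \<open>A\<close> good if each proper subspace \<open>W\<close> of \<open>A\<close> that is stable under \<open>S\<close> can be enlarged by a
  vector that \<open>S\<close> sends into \<open>W\<close>. Taking \<open>W = S\<close> yields an element outside \<open>S\<close> that normalizes
  \<open>S\<close>; the last of its powers outside \<open>S\<close> also has its square in \<open>S\<close>, so adjoining that power to
  \<open>S\<close> gives a subalgebra, which is good again (\<open>engel_on_extend\<close>). A maximal good subalgebra is therefore \<open>A\<close> itself. Hence the upper central series \<open>Z\<^sub>k\<close> of \<open>A\<close>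
  climbs up to \<open>A\<close>. Since the power \<open>A\<^sup>i\<close> sends \<open>Z\<^sub>k\<close> into \<open>Z\<^bsub>k-i\<^esub>\<close>
  (\<open>poisson_power_upper_central\<close>), a sufficiently high power of \<open>A\<close> vanishes.\<close>

section \<open>Elementary identities\<close>

locale finite_dimensional_poisson_algebra =
  poisson_algebra scale mult bracket + finite_dimensional_vector_space scale Basis
  for scale :: "'f::field \<Rightarrow> 'a::ab_group_add \<Rightarrow> 'a"
    and mult bracket :: "'a \<Rightarrow> 'a \<Rightarrow> 'a"
    and Basis :: "'a set"

context poisson_algebra
begin

lemma mult_zero_right: "mult x 0 = 0"
  using mult_zero_left mult_commute by metis

lemma bracket_zero_right: "bracket x 0 = 0"
  using bracket_scale_right[of x 0 0] by simp

lemma bracket_anticommute: "bracket x y = - bracket y x"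
proof -
  have "0 = bracket (x + y) (x + y)" by (simp only: bracket_self)
  also have "\<dots> = bracket x y + bracket y x"
    unfolding bracket_add_left bracket_add_right by (simp add: bracket_self)
  finally show ?thesis by (simp add: eq_neg_iff_add_eq_0)
qed

lemma bracket_minus_right: "bracket x (- y) = - bracket x y"
  using bracket_add_right[of x y "- y"] by (simp add: bracket_zero_right eq_neg_iff_add_eq_0 add.commute)

lemma mult_minus_right: "mult x (- y) = - mult x y"
  using mult_add_right[of x y "- y"] by (simp add: mult_zero_right eq_neg_iff_add_eq_0 add.commute)

lemma mult_left_commute: "mult x (mult y z) = mult y (mult x z)"
  by (metis mult_assoc mult_commute)

lemma bracket_derivation_bracket:
  "bracket a (bracket x y) = bracket (bracket a x) y + bracket x (bracket a y)"
proof -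
  have "bracket y (bracket a x) = - bracket (bracket a x) y"
    by (rule bracket_anticommute)
  moreover have "bracket x (bracket y a) = - bracket x (bracket a y)"
    by (metis bracket_anticommute bracket_minus_right)
  ultimately show ?thesis
    using jacobi[of a x y] by (simp add: algebra_simps)
qed

lemma bracket_derivation_mult:
  "bracket a (mult x y) = mult (bracket a x) y + mult x (bracket a y)"
proof -
  have "bracket a (mult x y) = - (mult (bracket x a) y + mult x (bracket y a))"
    by (metis bracket_anticommute leibniz)
  also have "mult (bracket x a) y = - mult (bracket a x) y"
    by (metis bracket_anticommute mult_minus_right mult_commute)
  also have "mult x (bracket y a) = - mult x (bracket a y)"
    by (metis bracket_anticommute mult_minus_right)
  finally show ?thesis by simp
qed

section \<open>Null components of multiplications and brackets\<close>

definition null_component :: "('a \<Rightarrow> 'a) \<Rightarrow> 'a set" where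
  "null_component D = {v. \<exists>n. (D ^^ n) v = 0}"

lemma module_hom_funpow:
  assumes "module_hom scale scale D"
  shows "module_hom scale scale (D ^^ n)"
proof (induction n)
  case 0
  show ?case using module_hom_ident by (simp add: module_hom_iff_linear)
next
  case (Suc n)
  show ?case using module_hom_compose[OF Suc assms] by (simp add: comp_def)
qed

lemma subspace_null_component:
  assumes D: "module_hom scale scale D"
  shows "subspace (null_component D)"
proof -
  have zero: "(D ^^ n) 0 = 0" for n
    using module_hom.zero[OF module_hom_funpow[OF D]] .
  have later: "(D ^^ (m + n)) v = 0" if "(D ^^ n) v = 0" for m n v
    using that zero by (simp add: funpow_add)
  show ?thesis
  proof (rule subspaceI)
    show "0 \<in> null_component D"
      using zero by (auto simp: null_component_def)
  next
    fix x y assume "x \<in> null_component D" "y \<in> null_component D"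
    then obtain m n where "(D ^^ m) x = 0" "(D ^^ n) y = 0"
      by (auto simp: null_component_def)
    then have "(D ^^ (n + m)) x = 0" "(D ^^ (m + n)) y = 0"
      using later by blast+
    then have "(D ^^ (m + n)) (x + y) = 0"
      using module_hom.add[OF module_hom_funpow[OF D]] by (simp add: add.commute)
    then show "x + y \<in> null_component D"
      by (auto simp: null_component_def)
  next
    fix c x assume "x \<in> null_component D"
    then show "scale c x \<in> null_component D"
      using module_hom.scale[OF module_hom_funpow[OF D]] by (auto simp: null_component_def)
  qed
qed

lemma null_component_if_image: "D v \<in> null_component D \<Longrightarrow> v \<in> null_component D"
  unfolding null_component_def by (auto simp: funpow_swap1 intro: exI[of _ "Suc _"])

text \<open>Leibniz's rule expresses \<open>D (f x y)\<close> by two terms in which one argument is closer to being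
  killed, so induction on the sum of the two exponents applies.\<close>

lemma null_component_derivation_closed:
  assumes D: "module_hom scale scale D"
    and leib: "\<And>x y. D (f x y) = f (D x) y + f x (D y)"
    and zero: "\<And>y. f 0 y = 0" "\<And>x. f x 0 = 0"
    and xy: "x \<in> null_component D" "y \<in> null_component D"
  shows "f x y \<in> null_component D"
proof -
  have "f x y \<in> null_component D" if "(D ^^ m) x = 0" "(D ^^ n) y = 0" for m n x y
    using that
  proof (induction "m + n" arbitrary: m n x y rule: less_induct)
    case less
    show ?case
    proof (cases "m = 0 \<or> n = 0")
      case True
      then show ?thesis
        using less.prems zero subspace_0[OF subspace_null_component[OF D]] by auto
    next
      case False
      then obtain m' n' where mn: "m = Suc m'" "n = Suc n'"
        by (metis not0_implies_Suc)
      have "f (D x) y \<in> null_component D"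
        using less.hyps[of m' n "D x" y] less.prems mn by (simp add: funpow_swap1)
      moreover have "f x (D y) \<in> null_component D"
        using less.hyps[of m n' x "D y"] less.prems mn by (simp add: funpow_swap1)
      ultimately have "D (f x y) \<in> null_component D"
        unfolding leib by (rule subspace_add[OF subspace_null_component[OF D]])
      then show ?thesis by (rule null_component_if_image)
    qed
  qed
  with xy show ?thesis by (auto simp: null_component_def)
qed

lemma module_hom_mult: "module_hom scale scale (mult a)"
  by unfold_locales (simp_all add: mult_add_right mult_scale_right)

lemma module_hom_bracket: "module_hom scale scale (bracket a)"
  by unfold_locales (simp_all add: bracket_add_right bracket_scale_right)

lemma subalgebra_null_component_bracket: "subalgebra (null_component (bracket a))"
  unfolding subalgebra_def
  using subspace_null_component[OF module_hom_bracket]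
    null_component_derivation_closed[OF module_hom_bracket, of a mult,
      OF bracket_derivation_mult mult_zero_left mult_zero_right]
    null_component_derivation_closed[OF module_hom_bracket, of a bracket,
      OF bracket_derivation_bracket bracket_zero_left bracket_zero_right]
  by blast

lemma funpow_mult_mult: "(mult a ^^ n) (mult b x) = mult b ((mult a ^^ n) x)"
  by (induction n) (simp_all add: mult_left_commute)

text \<open>Multiplication by \<open>a\<close> is not a derivation, but the Leibniz rule gives
  \<open>a [x, y] = [a x, y] - [a, y] x\<close>. In the first term \<open>a x\<close> is killed by one power less than \<open>x\<close>,
  and the second is a multiple of \<open>x\<close>; so induction on the power that kills \<open>x\<close> suffices, for an
  arbitrary \<open>y\<close>.\<close>

lemma subalgebra_null_component_mult: "subalgebra (null_component (mult a))"
proof -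
  let ?N = "null_component (mult a)"
  have N: "subspace ?N" by (rule subspace_null_component[OF module_hom_mult])
  have absorb: "mult b x \<in> ?N" if "x \<in> ?N" for b x
    using that unfolding null_component_def mem_Collect_eq funpow_mult_mult
    by (metis mult_zero_right)
  have "bracket x y \<in> ?N" if "(mult a ^^ n) x = 0" for n x y
    using that
  proof (induction n arbitrary: x)
    case 0
    then show ?case using subspace_0[OF N] by (simp add: bracket_zero_left)
  next
    case (Suc n)
    have x: "x \<in> ?N" using Suc.prems unfolding null_component_def by blast
    have "bracket (mult a x) y \<in> ?N"
      using Suc by (simp add: funpow_swap1)
    moreover have "mult (bracket a y) x \<in> ?N" using x by (rule absorb)
    ultimately have "bracket (mult a x) y - mult (bracket a y) x \<in> ?N"
      by (rule subspace_diff[OF N])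
    then have "mult a (bracket x y) \<in> ?N" by (simp add: leibniz)
    then show ?case by (rule null_component_if_image)
  qed
  then show ?thesis
    unfolding subalgebra_def using N absorb by (auto simp: null_component_def)
qed

section \<open>Jacobson's form of Engel's theorem\<close>

definition drives_into :: "'a set \<Rightarrow> 'a \<Rightarrow> 'a set \<Rightarrow> bool" where
  "drives_into S v W \<longleftrightarrow> (\<forall>s\<in>S. mult s v \<in> W \<and> bracket s v \<in> W)"

text \<open>The usual conclusion of Engel's theorem, a nonzero vector annihilated by \<open>S\<close>, for every nonzero
  quotient \<open>A / W\<close> by an \<open>S\<close>-stable subspace. Demanding it for all \<open>W\<close> at once replaces quotient
  spaces by subspaces of \<open>A\<close>.\<close>

definition engel_on :: "'a set \<Rightarrow> 'a set \<Rightarrow> bool" where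
  "engel_on A S \<longleftrightarrow> (\<forall>W. subspace W \<longrightarrow> W \<subset> A \<longrightarrow> (\<forall>w\<in>W. drives_into S w W) \<longrightarrow>
     (\<exists>v\<in>A - W. drives_into S v W))"

definition nil_on :: "'a set \<Rightarrow> bool" where
  "nil_on A \<longleftrightarrow> (\<forall>a\<in>A. A \<subseteq> null_component (mult a) \<and> A \<subseteq> null_component (bracket a))"

lemma last_iterate_outside:
  assumes "v \<notin> W" "v \<in> null_component D" "0 \<in> W"
  obtains k where "(D ^^ k) v \<notin> W" "(D ^^ Suc k) v \<in> W"
proof -
  obtain n where "(D ^^ n) v = 0" using assms by (auto simp: null_component_def)
  then have "\<exists>n. (D ^^ n) v \<in> W" using assms(3) by metis
  moreover have "(D ^^ n) v \<notin> W" if "\<nexists>k. (D ^^ k) v \<notin> W \<and> (D ^^ Suc k) v \<in> W" for n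
    by (induction n) (use that assms(1) in auto)
  ultimately show ?thesis using that by blast
qed

text \<open>The vectors that \<open>S\<close> annihilates modulo \<open>W\<close> are stable under every \<open>x\<close> that normalizes \<open>S\<close>:
  commuting an operator of \<open>S\<close> past an operator of \<open>x\<close> costs only an operator of \<open>S\<close>, because
  \<open>[s, x] \<in> S\<close>.\<close>

lemma drives_into_iterate:
  assumes W: "subspace W" "\<And>w. w \<in> W \<Longrightarrow> mult x w \<in> W \<and> bracket x w \<in> W"
    and x: "drives_into S x S" "\<And>s. s \<in> S \<Longrightarrow> - s \<in> S"
    and v: "drives_into S v W"
  shows "drives_into S (mult x v) W" "drives_into S (bracket x v) W"
proof -
  have sv: "mult s v \<in> W" "bracket s v \<in> W" if "s \<in> S" for s
    using v that by (auto simp: drives_into_def)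
  have sx: "bracket s x \<in> S" if "s \<in> S" for s
    using x that by (auto simp: drives_into_def)
  show "drives_into S (mult x v) W"
    unfolding drives_into_def
  proof (intro ballI conjI)
    fix s assume s: "s \<in> S"
    show "mult s (mult x v) \<in> W"
      using W(2) sv[OF s] by (simp add: mult_left_commute[of s])
    show "bracket s (mult x v) \<in> W"
      unfolding bracket_derivation_mult
      using W(2) sv[OF s] sv[OF sx[OF s]] by (intro subspace_add[OF W(1)]) auto
  qed
  show "drives_into S (bracket x v) W"
    unfolding drives_into_def
  proof (intro ballI conjI)
    fix s assume s: "s \<in> S"
    have "mult s (bracket x v) = bracket x (mult s v) - mult (bracket x s) v"
      by (simp add: bracket_derivation_mult)
    moreover have "bracket x s \<in> S" using x sx[OF s] bracket_anticommute by metis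
    ultimately show "mult s (bracket x v) \<in> W"
      using W(2) sv s by (auto intro: subspace_diff[OF W(1)])
    show "bracket s (bracket x v) \<in> W"
      using W(2) sv[OF s] sv[OF sx[OF s]]
      by (subst bracket_derivation_bracket) (simp add: subspace_add[OF W(1)])
  qed
qed

lemma drives_into_span_insert:
  assumes "subspace S" "subspace W" "drives_into S v W" "mult x v \<in> W" "bracket x v \<in> W"
  shows "drives_into (span (insert x S)) v W"
  unfolding drives_into_def
proof (intro ballI)
  fix t assume "t \<in> span (insert x S)"
  then obtain k where "t - scale k x \<in> S"
    using span_breakdown_eq[of t x S] assms(1) by (metis span_eq_iff)
  then obtain s where "s \<in> S" "t = s + scale k x" by (metis diff_add_cancel)
  then show "mult t v \<in> W \<and> bracket t v \<in> W"
    using assms unfolding drives_into_def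
    by (simp add: mult_add_left bracket_add_left mult_scale_left bracket_scale_left
        subspace_add subspace_scale)
qed

text \<open>Starting from a vector outside \<open>W\<close> that \<open>S\<close> sends into \<open>W\<close>, apply multiplication by \<open>x\<close> as often
  as the result stays outside \<open>W\<close>, and then bracketing with \<open>x\<close>. Since \<open>[x, x] = 0\<close> these two
  operators commute, so the second stage keeps what the first one achieved.\<close>

lemma engel_on_extend:
  assumes A: "subalgebra A" "nil_on A"
    and S: "subspace S" "engel_on A S"
    and x: "x \<in> A" "drives_into S x S"
  shows "engel_on A (span (insert x S))"
  unfolding engel_on_def
proof (intro allI impI)
  fix W
  assume W: "subspace W" "W \<subset> A" and stable: "\<forall>w\<in>W. drives_into (span (insert x S)) w W"
  have Wx: "mult x w \<in> W \<and> bracket x w \<in> W" if "w \<in> W" for w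
    using stable that by (auto simp: drives_into_def span_base)
  have "\<forall>w\<in>W. drives_into S w W"
    using stable by (auto simp: drives_into_def span_base)
  then obtain v where v: "v \<in> A - W" "drives_into S v W"
    using S W unfolding engel_on_def by blast
  have closed: "mult x u \<in> A" "bracket x u \<in> A" if "u \<in> A" for u
    using A(1) x(1) that by (auto simp: subalgebra_def)
  have step: "drives_into S (mult x u) W" "drives_into S (bracket x u) W"
    if "drives_into S u W" for u
    using drives_into_iterate[OF W(1) _ x(2) _ that] Wx subspace_neg[OF S(1)] by auto
  have nil: "u \<in> null_component (mult x)" "u \<in> null_component (bracket x)" if "u \<in> A" for u
    using A(2) x(1) that by (auto simp: nil_on_def)
  obtain i where i: "(mult x ^^ i) v \<notin> W" "(mult x ^^ Suc i) v \<in> W"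
    using last_iterate_outside[of v W "mult x"] v nil subspace_0[OF W(1)] by blast
  define u where "u = (mult x ^^ i) v"
  have "(mult x ^^ n) v \<in> A \<and> drives_into S ((mult x ^^ n) v) W" for n
    by (induction n) (use v closed step in auto)
  then have u: "u \<in> A" "u \<notin> W" "drives_into S u W" "mult x u \<in> W"
    using i by (auto simp: u_def)
  obtain j where j: "(bracket x ^^ j) u \<notin> W" "(bracket x ^^ Suc j) u \<in> W"
    using last_iterate_outside[of u W "bracket x"] u nil subspace_0[OF W(1)] by blast
  have "(bracket x ^^ n) u \<in> A \<and> drives_into S ((bracket x ^^ n) u) W \<and>
      mult x ((bracket x ^^ n) u) \<in> W" for n
  proof (induction n)
    case 0
    show ?case using u by simp
  next
    case (Suc n)
    have "mult x (bracket x y) = bracket x (mult x y)" for y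
      by (simp add: bracket_derivation_mult bracket_self mult_zero_left)
    then show ?case using Suc closed step Wx by auto
  qed
  then show "\<exists>v\<in>A - W. drives_into (span (insert x S)) v W"
    using j by (intro bexI[of _ "(bracket x ^^ j) u"] drives_into_span_insert S W) auto
qed

text \<open>Normalizing \<open>S\<close> is not enough in a Poisson algebra: the square of \<open>x\<close> must be controlled as well,
  whereas \<open>[x, x] = 0\<close> is automatic.\<close>

lemma subalgebra_span_insert:
  assumes S: "subalgebra S" and x: "drives_into S x S" "mult x x \<in> S"
  shows "subalgebra (span (insert x S))"
proof -
  let ?T = "span (insert x S)"
  have T: "subspace ?T" by simp
  have ST: "S \<subseteq> ?T" by (meson span_superset subset_insertI subset_trans)
  have "drives_into ?T s ?T" if "s \<in> S" for s
  proof (rule drives_into_span_insert[OF subspace_subalgebra[OF S] T])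
    show "drives_into S s ?T" using S ST that by (auto simp: drives_into_def subalgebra_def)
    show "mult x s \<in> ?T" using x ST that mult_commute[of x s] by (auto simp: drives_into_def)
    show "bracket x s \<in> ?T"
      using x ST that bracket_anticommute[of x s] subspace_neg[OF T]
      by (auto simp: drives_into_def)
  qed
  moreover have "drives_into ?T x ?T"
    using x ST subspace_0[OF T]
    by (intro drives_into_span_insert[OF subspace_subalgebra[OF S] T])
      (auto simp: drives_into_def bracket_self)
  \<comment> \<open>So far one factor is \<open>x\<close> or in \<open>S\<close>; linearity in that factor gives the rest.\<close>
  ultimately have gen: "mult t y \<in> ?T" "bracket t y \<in> ?T" if "y \<in> insert x S" "t \<in> ?T" for t y
    using that by (auto simp: drives_into_def)
  have "mult t y \<in> ?T \<and> bracket t y \<in> ?T" if "t \<in> ?T" "y \<in> ?T" for t y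
    using that(2)
  proof (induction rule: span_induct_alt)
    case base
    show ?case using subspace_0[OF T] by (simp add: mult_zero_right bracket_zero_right)
  next
    case (step c y z)
    then show ?case using gen that(1)
      by (simp add: mult_add_right bracket_add_right mult_scale_right bracket_scale_right
          span_add span_scale)
  qed
  then show ?thesis by (auto simp: subalgebra_def)
qed

section \<open>The upper central series and the powers\<close>

primrec upper_central :: "'a set \<Rightarrow> nat \<Rightarrow> 'a set" where
  "upper_central A 0 = {0}"
| "upper_central A (Suc k) = {z \<in> A. drives_into A z (upper_central A k)}"

lemma subspace_upper_central:
  assumes "subspace A"
  shows "subspace (upper_central A k)"
proof (induction k)
  case 0
  show ?case by (simp add: subspace_single_0)
next
  case (Suc k)
  show ?case
    using assms Suc
    by (auto intro!: subspaceI simp: drives_into_def subspace_0 subspace_add subspace_scale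
        mult_zero_right bracket_zero_right mult_add_right bracket_add_right
        mult_scale_right bracket_scale_right)
qed

lemma upper_central_Suc_superset:
  assumes "subspace A"
  shows "upper_central A k \<subseteq> upper_central A (Suc k)"
proof (induction k)
  case 0
  show ?case
    using assms by (auto simp: drives_into_def subspace_0 mult_zero_right bracket_zero_right)
next
  case (Suc k)
  then show ?case by (auto simp: drives_into_def)
qed

lemma upper_central_subset: "subspace A \<Longrightarrow> upper_central A k \<subseteq> A"
  by (cases k) (auto simp: subspace_0)

lemma poisson_power_subset_subspace:
  assumes "n \<ge> 2" "subspace W"
    and "\<And>i j x y. \<lbrakk>i \<ge> 1; j \<ge> 1; i + j = n; x \<in> poisson_power A i; y \<in> poisson_power A j\<rbrakk>
           \<Longrightarrow> mult x y \<in> W \<and> bracket x y \<in> W"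
  shows "poisson_power A n \<subseteq> W"
proof -
  have "mult_span (poisson_power A i) (poisson_power A (n - i)) \<subseteq> W"
       "bracket_span (poisson_power A i) (poisson_power A (n - i)) \<subseteq> W" if "i \<in> {1..<n}" for i
    unfolding mult_span_def bracket_span_def
    using assms(3)[of i "n - i"] that by (intro span_minimal assms(2); force)+
  then have "(\<Union>i\<in>{1..<n}. mult_span (poisson_power A i) (poisson_power A (n - i)) \<union>
                bracket_span (poisson_power A i) (poisson_power A (n - i))) \<subseteq> W"
    by (intro UN_least Un_least)
  then show ?thesis
    using assms(1) span_minimal[OF _ assms(2)] by (subst poisson_power.simps) simp
qed

lemma poisson_power_subset:
  assumes "subalgebra A"
  shows "poisson_power A n \<subseteq> A"
proof (induction n rule: less_induct)
  case (less n)
  show ?case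
  proof (cases "n \<ge> 2")
    case True
    then show ?thesis
    proof (rule poisson_power_subset_subspace)
      show "subspace A" using assms by (rule subspace_subalgebra)
    next
      fix i j x y
      assume "i \<ge> 1" "j \<ge> 1" "i + j = n" "x \<in> poisson_power A i" "y \<in> poisson_power A j"
      moreover from this have "x \<in> A" "y \<in> A" using less[of i] less[of j] by auto
      ultimately show "mult x y \<in> A \<and> bracket x y \<in> A"
        using assms by (simp add: subalgebra_def)
    qed
  next
    case False
    then show ?thesis by (subst poisson_power.simps) simp
  qed
qed

text \<open>An element of \<open>A\<^sup>i\<close> is a combination of products \<open>x y\<close> and \<open>[x, y]\<close> with \<open>x \<in> A\<^sup>p\<close>, \<open>y \<in> A\<^sup>q\<close> and
  \<open>p + q = i\<close>. Associativity, the Leibniz rule and the Jacobi identity rewrite its action on \<open>z\<close> as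
  a combination of successive actions of \<open>x\<close> and \<open>y\<close>, which lower the index by \<open>p\<close> and \<open>q\<close>.
  Truncated subtraction is harmless since \<open>Z\<^sub>0 = 0\<close>.\<close>

lemma poisson_power_upper_central:
  assumes A: "subspace A" and "i \<ge> 1" "z \<in> upper_central A k"
  shows "\<forall>a\<in>poisson_power A i. mult a z \<in> upper_central A (k - i) \<and>
                               bracket a z \<in> upper_central A (k - i)"
  using assms(2,3)
proof (induction i arbitrary: k z rule: less_induct)
  case (less i)
  let ?Z = "upper_central A"
  show ?case
  proof (cases "i \<ge> 2")
    case False
    with less.prems have "i = 1" by simp
    then show ?thesis
      using less.prems subspace_0[OF A]
      by (cases k) (auto simp: poisson_power_1[simplified] mult_zero_right bracket_zero_right drives_into_def)
  next
    case True
    let ?W = "{a. mult a z \<in> ?Z (k - i) \<and> bracket a z \<in> ?Z (k - i)}"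
    have Z: "subspace (?Z l)" for l by (rule subspace_upper_central[OF A])
    have "poisson_power A i \<subseteq> ?W"
    proof (rule poisson_power_subset_subspace[OF True])
      show "subspace ?W"
        by (auto intro!: subspaceI simp: subspace_0[OF Z] subspace_add[OF Z] subspace_scale[OF Z]
            mult_zero_left bracket_zero_left mult_add_left bracket_add_left
            mult_scale_left bracket_scale_left)
    next
      fix p q x y
      assume pq: "p \<ge> 1" "q \<ge> 1" "p + q = i"
        and x: "x \<in> poisson_power A p" and y: "y \<in> poisson_power A q"
      have eq: "k - q - p = k - i" "k - p - q = k - i" using pq by auto
      have xz: "mult x z \<in> ?Z (k - p)" "bracket x z \<in> ?Z (k - p)"
        using less.IH[of p z k] less.prems pq x by auto
      have yz: "mult y z \<in> ?Z (k - q)" "bracket y z \<in> ?Z (k - q)"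
        using less.IH[of q z k] less.prems pq y by auto
      have xx: "mult x u \<in> ?Z (k - i) \<and> bracket x u \<in> ?Z (k - i)" if "u \<in> ?Z (k - q)" for u
        using less.IH[of p u "k - q"] pq x that eq by auto
      have yy: "mult y u \<in> ?Z (k - i) \<and> bracket y u \<in> ?Z (k - i)" if "u \<in> ?Z (k - p)" for u
        using less.IH[of q u "k - p"] pq y that eq by auto
      have "mult (mult x y) z = mult x (mult y z)"
        by (rule mult_assoc)
      moreover have "bracket (mult x y) z = mult y (bracket x z) + mult x (bracket y z)"
        by (simp add: leibniz mult_commute)
      moreover have "mult (bracket x y) z = bracket x (mult y z) - mult y (bracket x z)"
        by (simp add: bracket_derivation_mult)
      moreover have "bracket (bracket x y) z = bracket x (bracket y z) - bracket y (bracket x z)"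
        using bracket_derivation_bracket[of x y z] by simp
      ultimately show "mult x y \<in> ?W \<and> bracket x y \<in> ?W"
        using xx yy xz yz by (simp add: subspace_add[OF Z] subspace_diff[OF Z])
    qed
    then show ?thesis by auto
  qed
qed

text \<open>An element of \<open>A\<^sup>i\<close> with \<open>i \<ge> n\<close> annihilates \<open>Z\<^sub>n = A\<close>. If \<open>i + j = 2 n + 2\<close>, one of \<open>i\<close>, \<open>j\<close> is
  at least \<open>n\<close>, so all the products that span \<open>A\<^bsup>2n+2\<^esup>\<close> vanish. The summand 2 keeps the exponent
  in the range where the recursion for powers applies, also for \<open>n = 0\<close>.\<close>

lemma nilpotent_if_upper_central:
  assumes A: "subalgebra A" and n: "upper_central A n = A"
  shows "nilpotent A"
proof -
  note sub = subspace_subalgebra[OF A]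
  have kill: "mult x y = 0" "bracket x y = 0"
    if "x \<in> poisson_power A i" "y \<in> A" "i \<ge> 1" "i \<ge> n" for i x y
    using poisson_power_upper_central[OF sub, of i y n] that n by auto
  have "poisson_power A (2 * n + 2) \<subseteq> {0}"
  proof (rule poisson_power_subset_subspace)
    fix i j x y
    assume ij: "i \<ge> 1" "j \<ge> 1" "i + j = 2 * n + 2"
      and x: "x \<in> poisson_power A i" and y: "y \<in> poisson_power A j"
    have "x \<in> A" "y \<in> A" using x y poisson_power_subset[OF A] by auto
    show "mult x y \<in> {0} \<and> bracket x y \<in> {0}"
    proof (cases "i \<ge> n")
      case True
      then show ?thesis using kill x \<open>y \<in> A\<close> ij by auto
    next
      case False
      then have "mult y x = 0" "bracket y x = 0"
        using kill[OF y \<open>x \<in> A\<close>] ij by auto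
      then show ?thesis using mult_commute[of x y] bracket_anticommute[of x y] by simp
    qed
  qed (simp_all add: subspace_single_0)
  moreover have "0 \<in> poisson_power A (2 * n + 2)"
    by (subst poisson_power.simps) (simp add: span_zero)
  ultimately have "poisson_power A (2 * n + 2) = {0}" by auto
  then show ?thesis
    using A unfolding nilpotent_def by (metis le_add2 one_le_numeral order_trans)
qed

end

section \<open>Finite dimension: elements of the Frattini ideal act nilpotently\<close>

context finite_dimensional_poisson_algebra
begin

lemma maximal_subspace_exists:
  assumes "S \<in> \<S>" "\<And>T. T \<in> \<S> \<Longrightarrow> subspace T"
  shows "\<exists>M\<in>\<S>. S \<subseteq> M \<and> (\<forall>T\<in>\<S>. M \<subseteq> T \<longrightarrow> T = M)"
proof -
  let ?Q = "\<lambda>T. T \<in> \<S> \<and> S \<subseteq> T"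
  have "dim T < Suc dimension" for T
    using dim_subset_UNIV[of T] by (simp add: dimension_def)
  then have "\<exists>M. ?Q M \<and> (\<forall>T. ?Q T \<longrightarrow> dim T \<le> dim M)"
    by (intro ex_has_greatest_nat[where b = "Suc dimension" and k = S]) (use assms(1) in auto)
  then obtain M where M: "?Q M" "\<And>T. ?Q T \<Longrightarrow> dim T \<le> dim M" by blast
  have "T = M" if "T \<in> \<S>" "M \<subseteq> T" for T
    using subspace_dim_equal[of M T] M that assms(2) by auto
  with M show ?thesis by blast
qed

text \<open>Otherwise \<open>S\<close> lies in a maximal subalgebra; that contains the Frattini subalgebra too, hence
  everything.\<close>

lemma frattini_subalgebra_nongenerator:
  assumes S: "subalgebra S" and gen: "\<And>v. \<exists>s\<in>S. v - s \<in> frattini_subalgebra"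
  shows "S = UNIV"
proof (rule ccontr)
  assume "S \<noteq> UNIV"
  let ?\<S> = "{T. subalgebra T \<and> T \<noteq> UNIV}"
  have "\<exists>M\<in>?\<S>. S \<subseteq> M \<and> (\<forall>T\<in>?\<S>. M \<subseteq> T \<longrightarrow> T = M)"
    by (rule maximal_subspace_exists) (use S \<open>S \<noteq> UNIV\<close> subspace_subalgebra in simp_all)
  then obtain M where M: "subalgebra M" "M \<noteq> UNIV" "S \<subseteq> M"
    and max: "\<And>T. subalgebra T \<Longrightarrow> T \<noteq> UNIV \<Longrightarrow> M \<subseteq> T \<Longrightarrow> T = M"
    by auto
  then have "maximal_subalgebra M" unfolding maximal_subalgebra_def by blast
  then have F: "frattini_subalgebra \<subseteq> M" unfolding frattini_subalgebra_def by blast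
  have "v \<in> M" for v
  proof -
    obtain s where "s \<in> S" "v - s \<in> frattini_subalgebra" using gen by blast
    then have "(v - s) + s \<in> M"
      using F M by (intro subspace_add[OF subspace_subalgebra[OF M(1)]]) auto
    then show ?thesis by simp
  qed
  with M(2) show False by blast
qed

text \<open>The ranges of the powers of \<open>D\<close> decrease, so they are constant from some \<open>n\<close> on. Then
  \<open>D\<^sup>n v = D\<^bsup>2n+1\<^esup> u\<close> for some \<open>u\<close>, and \<open>D\<^sup>n\<close> kills the difference of \<open>v\<close> and \<open>D\<^bsup>n+1\<^esup> u\<close>; the
  extra factor \<open>D\<close> puts this last vector into the range of \<open>D\<close> even if \<open>n = 0\<close>.\<close>

lemma fitting:
  assumes D: "module_hom scale scale D"
  shows "\<exists>u. v - D u \<in> null_component D"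
proof -
  let ?R = "\<lambda>n. range (D ^^ n)"
  have sub: "subspace (?R n)" for n
    using module_hom.subspace_image[OF module_hom_funpow[OF D] subspace_UNIV] .
  obtain n where n: "\<And>m. dim (?R n) \<le> dim (?R m)"
    using ex_has_least_nat[of "\<lambda>_. True" _ "\<lambda>n. dim (?R n)"] by blast
  have "?R (n + m) = ?R n" for m
  proof (rule subspace_dim_equal)
    show "?R (n + m) \<subseteq> ?R n" by (auto simp: funpow_add)
  qed (use sub n in blast)+
  from this[of "Suc n"] have "?R (n + Suc n) = ?R n" .
  then obtain u where "(D ^^ n) v = (D ^^ (n + Suc n)) u" by (metis rangeI imageE)
  then have "(D ^^ n) (v - D ((D ^^ n) u)) = 0"
    using module_hom.diff[OF module_hom_funpow[OF D]] by (simp add: funpow_add funpow_swap1)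
  then show ?thesis by (auto simp: null_component_def)
qed

lemma null_component_eq_UNIV:
  assumes D: "module_hom scale scale D"
    and "subalgebra (null_component D)" "range D \<subseteq> frattini_subalgebra"
  shows "null_component D = UNIV"
proof (rule frattini_subalgebra_nongenerator)
  fix v
  obtain u where "v - D u \<in> null_component D" using fitting[OF D] by blast
  moreover have "v - (v - D u) \<in> frattini_subalgebra" using assms(3) by auto
  ultimately show "\<exists>s\<in>null_component D. v - s \<in> frattini_subalgebra" by blast
qed fact

lemma nil_on_frattini_ideal: "nil_on frattini_ideal"
  unfolding nil_on_def
proof (intro ballI conjI)
  fix a assume "a \<in> frattini_ideal"
  then have "mult a p \<in> frattini_subalgebra" "bracket a p \<in> frattini_subalgebra" for p
    using poisson_ideal_frattini_ideal frattini_ideal_subset by (auto simp: poisson_ideal_def)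
  then have "null_component (mult a) = UNIV" "null_component (bracket a) = UNIV"
    using null_component_eq_UNIV[OF module_hom_mult subalgebra_null_component_mult]
      null_component_eq_UNIV[OF module_hom_bracket subalgebra_null_component_bracket]
    by blast+
  then show "frattini_ideal \<subseteq> null_component (mult a)"
    "frattini_ideal \<subseteq> null_component (bracket a)" by auto
qed

section \<open>Nilpotency\<close>

text \<open>The zero subalgebra has the Engel property, and a maximal subalgebra of \<open>A\<close> with this property
  cannot be proper: the property itself, for \<open>W = S\<close>, provides an element by which \<open>S\<close> extends.\<close>

lemma engel_on_self:
  assumes A: "subalgebra A" "nil_on A"
  shows "engel_on A A"
proof -
  let ?\<S> = "{S. subalgebra S \<and> S \<subseteq> A \<and> engel_on A S}"
  have "{0} \<in> ?\<S>"
    using subspace_0[OF subspace_subalgebra[OF A(1)]]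
    by (auto simp: subalgebra_def subspace_single_0 engel_on_def drives_into_def mult_zero_left
        bracket_zero_left subspace_0)
  then have "\<exists>S\<in>?\<S>. {0} \<subseteq> S \<and> (\<forall>T\<in>?\<S>. S \<subseteq> T \<longrightarrow> T = S)"
    by (rule maximal_subspace_exists) (use subspace_subalgebra in simp)
  then obtain S where S: "subalgebra S" "S \<subseteq> A" "engel_on A S"
    and max: "\<And>T. T \<in> ?\<S> \<Longrightarrow> S \<subseteq> T \<Longrightarrow> T = S"
    by auto
  have "S = A"
  proof (rule ccontr)
    assume "S \<noteq> A"
    moreover have "\<forall>s\<in>S. drives_into S s S"
      using S(1) by (auto simp: drives_into_def subalgebra_def)
    ultimately obtain v where v: "v \<in> A" "v \<notin> S" "drives_into S v S"
      using S subspace_subalgebra unfolding engel_on_def by blast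
    have sub: "subspace S" using S(1) by (rule subspace_subalgebra)
    \<comment> \<open>All powers of \<open>v\<close> normalize \<open>S\<close>, and high ones vanish. The last power \<open>x\<close> of \<open>v\<close> outside
      \<open>S\<close> has its square in \<open>S\<close>, as that is a higher power.\<close>
    obtain k where k: "(mult v ^^ k) v \<notin> S" "(mult v ^^ Suc k) v \<in> S"
      using last_iterate_outside[of v S "mult v"] v A(2) subspace_0[OF sub]
      by (auto simp: nil_on_def)
    define x where "x = (mult v ^^ k) v"
    have vS: "mult v s \<in> S \<and> bracket v s \<in> S" if "s \<in> S" for s
      using v that mult_commute[of v s] bracket_anticommute[of v s] subspace_neg[OF sub]
      by (auto simp: drives_into_def)
    have pow: "(mult v ^^ n) v \<in> A \<and> drives_into S ((mult v ^^ n) v) S" for n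
    proof (induction n)
      case 0
      show ?case using v by simp
    next
      case (Suc n)
      then show ?case
        using drives_into_iterate(1)[OF sub vS v(3)] subspace_neg[OF sub] A(1) v(1)
        by (auto simp: subalgebra_def)
    qed
    have "mult x x = (mult v ^^ k) (mult v x)"
      unfolding x_def by (metis funpow_mult_mult mult_commute)
    moreover have "mult v x \<in> S" using k by (simp add: x_def)
    moreover have "(mult v ^^ n) s \<in> S" if "s \<in> S" for n s
      by (induction n) (use that vS in auto)
    ultimately have "mult x x \<in> S" by simp
    moreover have x: "x \<in> A" "x \<notin> S" "drives_into S x S"
      using k pow by (auto simp: x_def)
    moreover have "span (insert x S) \<subseteq> A"
      using x S by (intro span_minimal subspace_subalgebra[OF A(1)]) auto
    ultimately have "span (insert x S) \<in> ?\<S>"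
      using subalgebra_span_insert[OF S(1)] engel_on_extend[OF A sub S(3)] by auto
    moreover have "insert x S \<subseteq> span (insert x S)" by (rule span_superset)
    ultimately show False using max x by auto
  qed
  with S show ?thesis by simp
qed

text \<open>As long as a term of the upper central series is proper, the Engel property with \<open>W\<close> equal to this
  term makes the next one strictly larger; finite dimension stops this.\<close>

lemma nilpotent_if_nil_on:
  assumes A: "subalgebra A" "nil_on A"
  shows "nilpotent A"
proof -
  note sub = subspace_subalgebra[OF A(1)]
  have "\<exists>M\<in>range (upper_central A). upper_central A 0 \<subseteq> M \<and>
      (\<forall>T\<in>range (upper_central A). M \<subseteq> T \<longrightarrow> T = M)"
    using subspace_upper_central[OF sub] by (intro maximal_subspace_exists rangeI) blast
  then obtain k where max:
    "\<And>l. upper_central A k \<subseteq> upper_central A l \<Longrightarrow> upper_central A l = upper_central A k"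
    by auto
  have "upper_central A k = A"
  proof (rule ccontr)
    assume "upper_central A k \<noteq> A"
    then have "upper_central A k \<subset> A" using upper_central_subset[OF sub] by blast
    moreover have "\<forall>w\<in>upper_central A k. drives_into A w (upper_central A k)"
      using upper_central_Suc_superset[OF sub, of k] by auto
    ultimately obtain v where "v \<in> A - upper_central A k" "drives_into A v (upper_central A k)"
      using engel_on_self[OF A] subspace_upper_central[OF sub] unfolding engel_on_def by blast
    then have "v \<in> upper_central A (Suc k) - upper_central A k" by simp
    then show False using max[OF upper_central_Suc_superset[OF sub]] by blast
  qed
  then show ?thesis by (rule nilpotent_if_upper_central[OF A(1)])
qed

end

theorem corollary4p2:
  fixes scale :: "'f::field \<Rightarrow> 'a::ab_group_add \<Rightarrow> 'a"
    and mult bracket :: "'a \<Rightarrow> 'a \<Rightarrow> 'a"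
    and Basis :: "'a set"
  assumes "poisson_algebra scale mult bracket"
    and "finite_dimensional_vector_space scale Basis"
  shows "poisson_algebra.nilpotent scale mult bracket
           (poisson_algebra.frattini_ideal scale mult bracket)"
proof -
  interpret finite_dimensional_poisson_algebra scale mult bracket Basis
    using assms by (rule finite_dimensional_poisson_algebra.intro)
  show ?thesis
    using subalgebra_poisson_ideal[OF poisson_ideal_frattini_ideal] nil_on_frattini_ideal
    by (rule nilpotent_if_nil_on)
qed

end
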